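(* Let $\mathcal A:\mathbb R^{n_1\times n_2}\to\mathbb R^m$ be linear and let $\mathbf X^0$ have rank at most $r$. If $\mathcal A$ satisfies the matrix RIP with $\delta_{2r}<0.4404$ and $\alpha\ge 10\|\mathbf X^0\|_2$ ($\alpha>0$), then $\mathbf X^0$ is the unique solution of problem (N2) with $\mathbf b=\mathcal A(\mathbf X^0)$.
   Context: Problem (N2) is $\min_{\mathbf X}\{\|\mathbf X\|_*+\frac{1}{2\alpha}\|\mathbf X\|_F^2:\ \mathcal A(\mathbf X)=\mathbf b\}$. The matrix RIP constant $\delta_r$ is the smallest value with $(1-\delta_r)\|\mathbf X\|_F^2\le\|\mathcal A(\mathbf X)\|_2^2\le(1+\delta_r)\|\mathbf X\|_F^2$ for all $\mathbf X$ of rank at most $r$. $\|\cdot\|_*$, $\|\cdot\|_F$, $\|\cdot\|_2$ are nuclear, Frobenius, spectral norms. *)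

theory Defs
  imports "HOL-Analysis.Analysis"
begin

text \<open>Matrices in R^(n1 x n2) are rendered as real^'n2^'n1 (rows indexed by 'n1).\<close>

definition frob_norm :: "real^'n^'m \<Rightarrow> real" where
  "frob_norm X = sqrt (\<Sum>i\<in>UNIV. \<Sum>j\<in>UNIV. (X $ i $ j)^2)"

definition spec_norm :: "real^'n^'m \<Rightarrow> real" where
  "spec_norm X = onorm (\<lambda>x. X *v x)"

definition outer :: "real^'m \<Rightarrow> real^'n \<Rightarrow> real^'n^'m" where
  "outer u v = (\<chi> i j. u $ i * v $ j)"

definition is_svd :: "real^'n^'m \<Rightarrow> (real \<times> (real^'m) \<times> (real^'n)) list \<Rightarrow> bool" where
  "is_svd X L \<longleftrightarrow>
     (\<forall>k<length L. fst (L!k) > 0) \<and>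
     (\<forall>j<length L. \<forall>k<length L.
        fst (snd (L!j)) \<bullet> fst (snd (L!k)) = (if j = k then 1 else 0) \<and>
        snd (snd (L!j)) \<bullet> snd (snd (L!k)) = (if j = k then 1 else 0)) \<and>
     X = (\<Sum>k<length L. fst (L!k) *\<^sub>R outer (fst (snd (L!k))) (snd (snd (L!k))))"

definition nuc_norm :: "real^'n^'m \<Rightarrow> real" where
  "nuc_norm X = (SOME s. \<exists>L. is_svd X L \<and> s = sum_list (map fst L))"

definition rip_const :: "(real^'n^'m \<Rightarrow> real^'p) \<Rightarrow> nat \<Rightarrow> real" where
  "rip_const A r = Inf {\<delta>. \<delta> \<ge> 0 \<and> (\<forall>X::real^'n^'m. rank X \<le> r \<longrightarrow>
       (1 - \<delta>) * (frob_norm X)^2 \<le> (norm (A X))^2 \<and>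
       (norm (A X))^2 \<le> (1 + \<delta>) * (frob_norm X)^2)}"

definition N2_obj :: "real \<Rightarrow> real^'n^'m \<Rightarrow> real" where
  "N2_obj \<alpha> X = nuc_norm X + (1 / (2 * \<alpha>)) * (frob_norm X)^2"

end

theory Submission
  imports Defs
begin

text \<open>
  Write \<open>H = X - X\<^sub>0\<close> with singular values \<open>t\<^sub>0 \<ge> t\<^sub>1 \<ge> \<dots>\<close>, and let \<open>F\<close> be the sum of the first \<open>r\<close> of them.
  The nuclear norm satisfies \<open>\<parallel>X\<^sub>0 + H\<parallel>\<^sub>* \<ge> \<parallel>X\<^sub>0\<parallel>\<^sub>* + \<parallel>H\<parallel>\<^sub>* - 2 F\<close>, a case of Mirsky's inequality, and
  \<open>\<bar>\<langle>X\<^sub>0, H\<rangle>\<bar> \<le> \<parallel>X\<^sub>0\<parallel>\<^sub>2 F \<le> \<alpha> F / 10\<close>. Expanding the objective at \<open>X\<^sub>0 + H\<close>, it therefore suffices that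
  \<open>2.1 F \<le> \<parallel>H\<parallel>\<^sub>*\<close> whenever \<open>A H = 0\<close>.

  Suppose this fails and let \<open>W\<close> be the part of \<open>H\<close> that belongs to the first \<open>r\<close> singular values. The
  remaining singular values are at most \<open>1.1 F / r\<close> and sum to at most \<open>1.1 F\<close>, and a linear functional on
  such weight vectors is dominated by its value on a vector with at most \<open>r\<close> entries, all equal to
  \<open>1.1 F / r\<close>. Applied to \<open>- \<langle>A (\<cdot>), A W\<rangle>\<close> this produces a matrix \<open>U\<close> of rank at most \<open>r\<close>, orthogonal
  to \<open>W\<close>, with \<open>\<parallel>U\<parallel>\<^sub>F \<le> 1.1 \<parallel>W\<parallel>\<^sub>F\<close> and \<open>\<parallel>A W\<parallel>\<^sup>2 \<le> - \<langle>A U, A W\<rangle>\<close>. By polarization, the restricted isometry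
  property for \<open>W\<close> and \<open>W \<plusminus> U\<close> gives \<open>1 - \<delta> \<le> \<delta> (1 + 1.21) / 2\<close>, which is false for \<open>\<delta> < 0.4404\<close>.
\<close>

section \<open>Orthonormal sequences and self-adjoint operators\<close>

definition orthonormal_seq :: "nat \<Rightarrow> (nat \<Rightarrow> 'a::real_inner) \<Rightarrow> bool" where
  "orthonormal_seq n e \<longleftrightarrow> (\<forall>i<n. \<forall>j<n. e i \<bullet> e j = (if i = j then 1 else 0))"

lemma orthonormal_seqD:
  "orthonormal_seq n e \<Longrightarrow> i < n \<Longrightarrow> j < n \<Longrightarrow> e i \<bullet> e j = (if i = j then 1 else 0)"
  by (simp add: orthonormal_seq_def)

lemma orthonormal_seq_mono: "orthonormal_seq n e \<Longrightarrow> k \<le> n \<Longrightarrow> orthonormal_seq k e"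
  by (simp add: orthonormal_seq_def)

lemma orthonormal_seq_inner_sum:
  assumes "orthonormal_seq n e" "I \<subseteq> {..<n}" "k < n"
  shows "e k \<bullet> (\<Sum>j\<in>I. c j *\<^sub>R e j) = (if k \<in> I then c k else 0)"
proof -
  have "finite I" using assms(2) finite_subset by blast
  have "e k \<bullet> (\<Sum>j\<in>I. c j *\<^sub>R e j) = (\<Sum>j\<in>I. c j * (e k \<bullet> e j))"
    by (simp add: inner_sum_right)
  also have "\<dots> = (\<Sum>j\<in>I. if j = k then c j else 0)"
    by (rule sum.cong) (use assms in \<open>auto simp: orthonormal_seq_def subset_iff\<close>)
  also have "\<dots> = (if k \<in> I then c k else 0)"
    using \<open>finite I\<close> by simp
  finally show ?thesis .
qed

lemma orthonormal_seq_inner_sum_sum: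
  assumes "orthonormal_seq n e" "I \<subseteq> {..<n}"
  shows "(\<Sum>j\<in>I. b j *\<^sub>R e j) \<bullet> (\<Sum>j\<in>I. c j *\<^sub>R e j) = (\<Sum>j\<in>I. b j * c j)"
proof -
  have "(\<Sum>j\<in>I. b j *\<^sub>R e j) \<bullet> (\<Sum>j\<in>I. c j *\<^sub>R e j)
      = (\<Sum>i\<in>I. b i * (e i \<bullet> (\<Sum>j\<in>I. c j *\<^sub>R e j)))"
    by (simp add: inner_sum_left)
  also have "\<dots> = (\<Sum>j\<in>I. b j * c j)"
    by (rule sum.cong[OF refl]) (use assms in \<open>auto simp: orthonormal_seq_inner_sum subset_iff\<close>)
  finally show ?thesis .
qed

lemma bessel_inequality:
  assumes "orthonormal_seq n e"
  shows "(\<Sum>k<n. (e k \<bullet> x)\<^sup>2) \<le> x \<bullet> x"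
proof -
  let ?y = "\<Sum>k<n. (e k \<bullet> x) *\<^sub>R e k"
  have 1: "?y \<bullet> ?y = (\<Sum>k<n. (e k \<bullet> x)\<^sup>2)"
    using orthonormal_seq_inner_sum_sum[OF assms subset_refl] by (simp add: power2_eq_square)
  have 2: "?y \<bullet> x = (\<Sum>k<n. (e k \<bullet> x)\<^sup>2)"
    by (simp add: inner_sum_left power2_eq_square)
  have "0 \<le> (x - ?y) \<bullet> (x - ?y)" by simp
  also have "\<dots> = x \<bullet> x - 2 * (?y \<bullet> x) + ?y \<bullet> ?y"
    by (simp add: inner_diff_left inner_diff_right inner_commute)
  finally show ?thesis using 1 2 by simp
qed

text \<open>Cauchy-Schwarz followed by Bessel. For unit vectors \<open>x\<close> and
  \<open>y\<close> the bound is 1, which is how the singular vectors of one matrix are compared with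
  those of another.\<close>

lemma bessel_inequality_product:
  assumes "orthonormal_seq n e" "orthonormal_seq n e'"
  shows "(\<Sum>k<n. \<bar>(e k \<bullet> x) * (e' k \<bullet> y)\<bar>) \<le> norm x * norm y"
proof -
  have "(\<Sum>k<n. \<bar>(e k \<bullet> x) * (e' k \<bullet> y)\<bar>)
      \<le> L2_set (\<lambda>k. e k \<bullet> x) {..<n} * L2_set (\<lambda>k. e' k \<bullet> y) {..<n}"
    using L2_set_mult_ineq[of "\<lambda>k. e k \<bullet> x" "\<lambda>k. e' k \<bullet> y" "{..<n}"] by (simp add: abs_mult)
  also have "\<dots> \<le> norm x * norm y"
    unfolding L2_set_def norm_eq_sqrt_inner
    by (intro mult_mono real_sqrt_le_mono bessel_inequality assms real_sqrt_ge_zero sum_nonneg) auto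
  finally show ?thesis .
qed

lemma orthonormal_seq_inj_on:
  assumes "orthonormal_seq n e"
  shows "inj_on e {..<n}"
proof (rule inj_onI)
  fix i j assume "i \<in> {..<n}" "j \<in> {..<n}" "e i = e j"
  then have "e i \<bullet> e j = e i \<bullet> e i" "i < n" "j < n" by auto
  then show "i = j" using assms by (auto simp: orthonormal_seq_def split: if_splits)
qed

lemma orthonormal_seq_independent:
  fixes e :: "nat \<Rightarrow> 'a::euclidean_space"
  assumes "orthonormal_seq n e" "I \<subseteq> {..<n}"
  shows "independent (e ` I)"
proof (rule pairwise_orthogonal_independent)
  show "pairwise orthogonal (e ` I)"
    using assms by (auto simp: pairwise_def orthogonal_def orthonormal_seq_def subset_iff)
  show "0 \<notin> e ` I"
    using assms by (force simp: orthonormal_seq_def subset_iff)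
qed

lemma dim_orthonormal_seq:
  fixes e :: "nat \<Rightarrow> 'a::euclidean_space"
  assumes "orthonormal_seq n e" "I \<subseteq> {..<n}"
  shows "dim (e ` I) = card I"
  using dim_eq_card_independent[OF orthonormal_seq_independent[OF assms]]
    card_image[OF inj_on_subset[OF orthonormal_seq_inj_on[OF assms(1)] assms(2)]] by simp

lemma orthonormal_seq_span:
  assumes "orthonormal_seq n e" "I \<subseteq> {..<n}" "x \<in> span (e ` I)"
  obtains c where "x = (\<Sum>j\<in>I. c j *\<^sub>R e j)"
proof -
  have fin: "finite I" using assms(2) finite_subset by blast
  obtain u where "x = (\<Sum>v\<in>e ` I. u v *\<^sub>R v)"
    using assms(3) fin by (auto simp: span_finite)
  also have "\<dots> = (\<Sum>j\<in>I. u (e j) *\<^sub>R e j)"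
    by (subst sum.reindex)
      (use inj_on_subset[OF orthonormal_seq_inj_on[OF assms(1)] assms(2)] in \<open>auto simp: o_def\<close>)
  finally show ?thesis using that[of "\<lambda>j. u (e j)"] by blast
qed

lemma orthonormal_seq_expand:
  fixes e :: "nat \<Rightarrow> 'a::euclidean_space"
  assumes "orthonormal_seq DIM('a) e"
  shows "x = (\<Sum>k<DIM('a). (e k \<bullet> x) *\<^sub>R e k)"
proof -
  have "span (e ` {..<DIM('a)}) = UNIV"
    using dim_orthonormal_seq[OF assms subset_refl] by (simp add: dim_eq_full)
  then obtain c where c: "x = (\<Sum>j\<in>{..<DIM('a)}. c j *\<^sub>R e j)"
    using orthonormal_seq_span[OF assms subset_refl] by (metis UNIV_I)
  have "e k \<bullet> x = c k" if "k < DIM('a)" for k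
    using orthonormal_seq_inner_sum[OF assms subset_refl that] that c by simp
  then show ?thesis using c by simp
qed

lemma parseval_identity:
  fixes e :: "nat \<Rightarrow> 'a::euclidean_space"
  assumes "orthonormal_seq DIM('a) e"
  shows "(\<Sum>k<DIM('a). (e k \<bullet> x)\<^sup>2) = x \<bullet> x"
proof -
  have "x \<bullet> x = (\<Sum>k<DIM('a). (e k \<bullet> x) *\<^sub>R e k) \<bullet> (\<Sum>k<DIM('a). (e k \<bullet> x) *\<^sub>R e k)"
    using orthonormal_seq_expand[OF assms, of x] by simp
  also have "\<dots> = (\<Sum>k<DIM('a). (e k \<bullet> x)\<^sup>2)"
    using orthonormal_seq_inner_sum_sum[OF assms subset_refl] by (simp add: power2_eq_square)
  finally show ?thesis by simp
qed

section \<open>Spectral theorem for self-adjoint operators\<close>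

text \<open>A nonnegative quadratic form is minimal at any zero \<open>x\<close>, so its derivative
  there vanishes in every direction of \<open>S\<close>; the direction \<open>g x\<close> forces
  \<open>g x\<close> itself to vanish.\<close>

lemma psd_form_kernel:
  fixes g :: "'a::real_inner \<Rightarrow> 'a"
  assumes lin: "linear g" and sym: "\<And>x y. g x \<bullet> y = x \<bullet> g y"
    and S: "subspace S" "g ` S \<subseteq> S" and psd: "\<And>z. z \<in> S \<Longrightarrow> 0 \<le> g z \<bullet> z"
    and x: "x \<in> S" "g x \<bullet> x = 0"
  shows "g x = 0"
proof (rule ccontr)
  assume "g x \<noteq> 0"
  define y where "y = g x"
  define p where "p = y \<bullet> y"
  define q where "q = g y \<bullet> y"
  have yS: "y \<in> S" using S x by (auto simp: y_def)
  have p: "p > 0" using \<open>g x \<noteq> 0\<close> by (simp add: p_def y_def)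
  have q: "q \<ge> 0" using psd[OF yS] by (simp add: q_def)
  have quad: "0 \<le> - 2 * t * p + t\<^sup>2 * q" for t
  proof -
    have "x - t *\<^sub>R y \<in> S" using S(1) x(1) yS by (intro subspace_diff subspace_mul)
    then have "0 \<le> g (x - t *\<^sub>R y) \<bullet> (x - t *\<^sub>R y)" by (rule psd)
    also have "\<dots> = g x \<bullet> x - t * (g x \<bullet> y) - t * (g y \<bullet> x) + t\<^sup>2 * (g y \<bullet> y)"
      by (simp add: linear_diff[OF lin] linear_cmul[OF lin] inner_diff_left inner_diff_right
          power2_eq_square algebra_simps)
    also have "g y \<bullet> x = p" by (simp add: sym p_def y_def)
    finally show ?thesis using x(2) by (simp add: p_def q_def y_def)
  qed
  \<comment> \<open>The vertex of the parabola is at \<open>p / q\<close>; the denominator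
    \<open>q + 1\<close> still gives a negative value and covers \<open>q = 0\<close>.\<close>
  have "0 \<le> - 2 * (p / (q + 1)) * p + (p / (q + 1))\<^sup>2 * q" by (rule quad)
  also have "\<dots> = - (p\<^sup>2 / (q + 1)\<^sup>2) * (q + 2)"
    using q by (simp add: power2_eq_square divide_simps) (simp add: algebra_simps)
  also have "\<dots> < 0" using p q by (intro mult_neg_pos) auto
  finally show False by simp
qed

text \<open>\<open>x\<close> maximizes the form of \<open>f\<close> on the compact unit sphere of
  \<open>S\<close>. Then \<open>l\<close> times the identity minus \<open>f\<close> has a form that
  is nonnegative on \<open>S\<close> and zero at \<open>x\<close>, so it maps \<open>x\<close> to
  0.\<close>

lemma selfadjoint_max_eigenvector:
  fixes f :: "'a::euclidean_space \<Rightarrow> 'a"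
  assumes lin: "linear f" and sym: "\<And>x y. f x \<bullet> y = x \<bullet> f y"
    and S: "subspace S" "f ` S \<subseteq> S" "S \<noteq> {0}"
  obtains x l where "x \<in> S" "x \<bullet> x = 1" "f x = l *\<^sub>R x" "\<And>z. z \<in> S \<Longrightarrow> f z \<bullet> z \<le> l * (z \<bullet> z)"
proof -
  obtain z0 where z0: "z0 \<in> S" "z0 \<noteq> 0" using S(1,3) subspace_0 by blast
  have unit: "(1 / norm z) *\<^sub>R z \<in> S \<inter> sphere 0 1" if "z \<in> S" "z \<noteq> 0" for z
    using that S(1) by (simp add: subspace_mul)
  have "compact (S \<inter> sphere 0 1)"
    using closed_subspace[OF S(1)] compact_sphere by (simp add: closed_Int_compact)
  moreover have "S \<inter> sphere 0 1 \<noteq> {}" using unit[OF z0] by blast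
  moreover have "continuous_on (S \<inter> sphere 0 1) (\<lambda>x. f x \<bullet> x)"
    by (intro continuous_intros linear_continuous_on linear_conv_bounded_linear[THEN iffD1] lin)
  ultimately obtain x where x: "x \<in> S \<inter> sphere 0 1"
    and max: "\<And>y. y \<in> S \<inter> sphere 0 1 \<Longrightarrow> f y \<bullet> y \<le> f x \<bullet> x"
    using continuous_attains_sup[of "S \<inter> sphere 0 1" "\<lambda>x. f x \<bullet> x"] by blast
  define l where "l = f x \<bullet> x"
  have xx: "x \<bullet> x = 1" using x by (simp add: norm_eq_1)
  have le: "f z \<bullet> z \<le> l * (z \<bullet> z)" if "z \<in> S" for z
  proof (cases "z = 0")
    case False
    have "f ((1 / norm z) *\<^sub>R z) \<bullet> ((1 / norm z) *\<^sub>R z) \<le> l"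
      using max[OF unit[OF that False]] by (simp add: l_def)
    then have "(f z \<bullet> z) / (norm z)\<^sup>2 \<le> l"
      by (simp add: linear_cmul[OF lin] power2_eq_square divide_inverse mult_ac)
    then show ?thesis using False by (simp add: divide_simps power2_norm_eq_inner)
  qed (simp add: linear_0[OF lin])
  define g where "g = (\<lambda>z. l *\<^sub>R z - f z)"
  have "g x = 0"
  proof (rule psd_form_kernel[where S = S and g = g and x = x])
    show "linear g"
      unfolding g_def
      by (rule linearI) (simp_all add: linear_add[OF lin] linear_cmul[OF lin] algebra_simps)
    show "g ` S \<subseteq> S"
      using S(1,2) by (auto simp: g_def intro!: subspace_diff subspace_mul)
  qed (use x S(1) le xx in \<open>auto simp: g_def inner_diff_left inner_diff_right sym l_def\<close>)
  then have "f x = l *\<^sub>R x" by (simp add: g_def)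
  then show ?thesis using that x xx le by blast
qed

text \<open>Induction on the dimension: a maximal eigenvector is split off, and its orthogonal
  complement in \<open>S\<close> is again invariant because \<open>f\<close> is self-adjoint.
  Maximality puts the eigenvalue split off first above all later ones.\<close>

lemma spectral_theorem_subspace:
  fixes f :: "'a::euclidean_space \<Rightarrow> 'a"
  assumes lin: "linear f" and sym: "\<And>x y. f x \<bullet> y = x \<bullet> f y"
  shows "subspace S \<Longrightarrow> f ` S \<subseteq> S \<Longrightarrow> dim S = n \<Longrightarrow>
    \<exists>e l. orthonormal_seq n e \<and> (\<forall>k<n. e k \<in> S \<and> f (e k) = l k *\<^sub>R e k) \<and>
      (\<forall>i j. i \<le> j \<longrightarrow> j < n \<longrightarrow> l j \<le> (l i :: real))"
proof (induction n arbitrary: S)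
  case 0
  show ?case by (simp add: orthonormal_seq_def)
next
  case (Suc n)
  then have "S \<noteq> {0}" by (metis dim_eq_0 Zero_not_Suc subset_refl)
  then obtain x m where x: "x \<in> S" "x \<bullet> x = 1" "f x = m *\<^sub>R x"
    and max: "\<And>z. z \<in> S \<Longrightarrow> f z \<bullet> z \<le> m * (z \<bullet> z)"
    using selfadjoint_max_eigenvector[OF lin sym] Suc.prems by metis
  define T where "T = {y \<in> S. \<forall>a\<in>span {x}. orthogonal a y}"
  have T: "T = {y \<in> S. x \<bullet> y = 0}"
    unfolding T_def by (auto simp: span_singleton orthogonal_def)
  have "dim T + dim (span {x}) = Suc n"
    using dim_subspace_orthogonal_to_vectors[of "span {x}" S] Suc.prems x
    by (simp add: T_def span_minimal)
  moreover have "x \<noteq> 0" using x by auto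
  ultimately have dimT: "dim T = n" by simp
  have sT: "subspace T"
    using Suc.prems(1) by (auto simp: T subspace_def inner_add_right)
  have fT: "f ` T \<subseteq> T"
    using Suc.prems(2) x by (auto simp: T sym[symmetric])
  obtain e l where el: "orthonormal_seq n e" "\<forall>k<n. e k \<in> T \<and> f (e k) = l k *\<^sub>R e k"
    "\<forall>i j. i \<le> j \<longrightarrow> j < n \<longrightarrow> l j \<le> l i"
    using Suc.IH[OF sT fT dimT] by blast
  have lm: "l k \<le> m" if "k < n" for k
    using max[of "e k"] el(1,2) that by (auto simp: T orthonormal_seq_def)
  have "orthonormal_seq (Suc n) (case_nat x e)"
    using el(1,2) x by (auto simp: orthonormal_seq_def T inner_commute split: nat.split)
  moreover have "\<forall>k<Suc n. case_nat x e k \<in> S \<and>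
      f (case_nat x e k) = case_nat m l k *\<^sub>R case_nat x e k"
    using el(2) x by (auto simp: T split: nat.split)
  moreover have "\<forall>i j. i \<le> j \<longrightarrow> j < Suc n \<longrightarrow> case_nat m l j \<le> case_nat m l i"
    using el(3) lm by (auto split: nat.split)
  ultimately show ?case by blast
qed

theorem spectral_theorem:
  fixes f :: "'a::euclidean_space \<Rightarrow> 'a"
  assumes "linear f" and "\<And>x y. f x \<bullet> y = x \<bullet> f y"
  obtains e and l :: "nat \<Rightarrow> real" where "orthonormal_seq DIM('a) e"
    "\<And>k. k < DIM('a) \<Longrightarrow> f (e k) = l k *\<^sub>R e k"
    "\<And>i j. i \<le> j \<Longrightarrow> j < DIM('a) \<Longrightarrow> l j \<le> l i"
  using spectral_theorem_subspace[of f UNIV "DIM('a)"] assms by auto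

section \<open>Eigenvalue bounds by dimension counting\<close>

text \<open>The span of the eigenvectors from index \<open>k\<close> on has codimension
  \<open>k\<close>, so it shares a nonzero vector with \<open>S\<close>; on that span the form is at
  most \<open>l k\<close> times the squared norm. Indices start at 0, so \<open>l k\<close> is the
  eigenvalue number \<open>k + 1\<close>.\<close>

lemma courant_fischer_lower_bound:
  fixes f :: "'a::euclidean_space \<Rightarrow> 'a" and l :: "nat \<Rightarrow> real"
  assumes lin: "linear f" and e: "orthonormal_seq DIM('a) e"
    and eig: "\<And>k. k < DIM('a) \<Longrightarrow> f (e k) = l k *\<^sub>R e k"
    and anti: "\<And>i j. i \<le> j \<Longrightarrow> j < DIM('a) \<Longrightarrow> l j \<le> l i"
    and k: "k < DIM('a)" and S: "subspace S" "k < dim S"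
    and low: "\<And>z. z \<in> S \<Longrightarrow> c * (z \<bullet> z) \<le> f z \<bullet> z"
  shows "c \<le> l k"
proof -
  let ?I = "{k..<DIM('a)}"
  let ?T = "span (e ` ?I)"
  have I: "?I \<subseteq> {..<DIM('a)}" by auto
  have "dim ?T = DIM('a) - k" using dim_orthonormal_seq[OF e I] by simp
  moreover have "dim {x + y |x y. x \<in> S \<and> y \<in> ?T} + dim (S \<inter> ?T) = dim S + dim ?T"
    by (rule dim_sums_Int) (use S in auto)
  moreover have "dim {x + y |x y. x \<in> S \<and> y \<in> ?T} \<le> DIM('a)"
    by (rule dim_subset_UNIV)
  ultimately have "dim (S \<inter> ?T) \<noteq> 0" using S(2) k by linarith
  then obtain z where z: "z \<in> S" "z \<in> ?T" "z \<noteq> 0"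
    unfolding dim_eq_0 by blast
  obtain d where d: "z = (\<Sum>j\<in>?I. d j *\<^sub>R e j)"
    using orthonormal_seq_span[OF e I z(2)] by blast
  have "f z = (\<Sum>j\<in>?I. (l j * d j) *\<^sub>R e j)"
    unfolding d linear_sum[OF lin] by (rule sum.cong) (auto simp: linear_cmul[OF lin] eig)
  then have "f z \<bullet> z = (\<Sum>j\<in>?I. (l j * d j) * d j)"
    unfolding d by (simp only: orthonormal_seq_inner_sum_sum[OF e I])
  also have "\<dots> \<le> (\<Sum>j\<in>?I. l k * (d j * d j))"
    by (rule sum_mono) (use anti in \<open>auto simp: mult.assoc intro!: mult_right_mono\<close>)
  also have "\<dots> = l k * (z \<bullet> z)"
    unfolding d by (simp only: orthonormal_seq_inner_sum_sum[OF e I] sum_distrib_left)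
  finally have "c * (z \<bullet> z) \<le> l k * (z \<bullet> z)" using low[OF z(1)] by simp
  then show ?thesis using z(3) by (simp add: inner_gt_zero_iff)
qed

text \<open>The vectors \<open>w j\<close> may be dependent, hence only an inequality. These
  complements are the test spaces for the small eigenvalues.\<close>

lemma dim_orthogonal_complement_ge:
  fixes w :: "nat \<Rightarrow> 'a::euclidean_space"
  shows "DIM('a) - k \<le> dim {z. \<forall>j<k. w j \<bullet> z = 0}"
    and "subspace {z. \<forall>j<k. w j \<bullet> z = 0}"
proof -
  have eq: "{y \<in> UNIV. \<forall>x\<in>span (w ` {..<k}). orthogonal x y} = {z. \<forall>j<k. w j \<bullet> z = 0}"
  proof (intro equalityI subsetI CollectI conjI ballI)
    fix y x assume y: "y \<in> {z. \<forall>j<k. w j \<bullet> z = 0}" and x: "x \<in> span (w ` {..<k})"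
    show "orthogonal x y"
      using x
    proof (rule span_induct)
      show "subspace {x. orthogonal x y}"
        by (auto simp: subspace_def orthogonal_def inner_add_left)
    qed (use y in \<open>auto simp: orthogonal_def\<close>)
  qed (auto simp: orthogonal_def intro: span_base)
  have "dim (w ` {..<k}) \<le> k"
    by (rule order.trans[OF dim_le_card']) (use card_image_le[of "{..<k}" w] in auto)
  then show "DIM('a) - k \<le> dim {z. \<forall>j<k. w j \<bullet> z = 0}"
    using dim_subspace_orthogonal_to_vectors[of "span (w ` {..<k})" UNIV]
    unfolding eq by simp
  show "subspace {z. \<forall>j<k. w j \<bullet> z = 0}"
    by (auto simp: subspace_def inner_add_right)
qed

section \<open>Singular value decomposition\<close>

lemma outer_mult_vec: "outer u v *v y = (v \<bullet> y) *\<^sub>R u"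
  by (simp add: outer_def matrix_vector_mult_def vec_eq_iff inner_vec_def sum_distrib_left mult_ac)

lemma inner_outer: "M \<bullet> outer u v = u \<bullet> (M *v v)"
  by (simp add: outer_def matrix_vector_mult_def inner_vec_def sum_distrib_left mult_ac)

lemma outer_inner_outer: "outer a b \<bullet> outer u v = (a \<bullet> u) * (b \<bullet> v)"
  by (simp add: inner_outer outer_mult_vec inner_commute)

lemma frob_norm_eq_norm: "frob_norm X = norm X"
  by (simp add: frob_norm_def norm_eq_sqrt_inner inner_vec_def power2_eq_square)

lemma sum_matrix_mult_vec: "(\<Sum>k\<in>I. M k) *v y = (\<Sum>k\<in>I. M k *v (y :: real^'n))"
  by (induction I rule: infinite_finite_induct) (auto simp: matrix_vector_mult_add_rdistrib)

lemma sum_outer_mult_vec: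
  "(\<Sum>k\<in>I. s k *\<^sub>R outer (u k) (v k)) *v y = (\<Sum>k\<in>I. (s k * (v k \<bullet> y)) *\<^sub>R u k)"
  by (simp add: sum_matrix_mult_vec scaleR_matrix_vector_assoc[symmetric] outer_mult_vec)

lemma inner_sum_outer_mult_vec:
  "x \<bullet> ((\<Sum>k\<in>I. s k *\<^sub>R outer (u k) (v k)) *v y) = (\<Sum>k\<in>I. s k * (u k \<bullet> x) * (v k \<bullet> y))"
  by (simp add: sum_outer_mult_vec inner_sum_right inner_commute mult_ac)

lemma orthonormal_seq_outer:
  "orthonormal_seq p u \<Longrightarrow> orthonormal_seq p v \<Longrightarrow> orthonormal_seq p (\<lambda>k. outer (u k) (v k))"
  by (simp add: orthonormal_seq_def outer_inner_outer)

lemma rank_sum_outer_le: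
  fixes u :: "nat \<Rightarrow> real^'m" and v :: "nat \<Rightarrow> real^'n"
  assumes "finite I"
  shows "rank (\<Sum>k\<in>I. s k *\<^sub>R outer (u k) (v k)) \<le> card I"
proof -
  have "range ((*v) (\<Sum>k\<in>I. s k *\<^sub>R outer (u k) (v k))) \<subseteq> span (u ` I)"
    by (auto simp: sum_outer_mult_vec intro: span_sum span_mul span_base)
  then have "dim (range ((*v) (\<Sum>k\<in>I. s k *\<^sub>R outer (u k) (v k)))) \<le> card (u ` I)"
    using assms by (intro dim_le_card) auto
  also have "\<dots> \<le> card I" using assms by (rule card_image_le)
  finally show ?thesis by (simp add: rank_dim_range)
qed

text \<open>Functions in place of the lists of \<open>is_svd\<close> allow padding by zeros:
  \<open>s\<close> is antitone on all indices, and sums of its first \<open>r\<close> values make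
  sense even when \<open>r\<close> exceeds \<open>p\<close>.\<close>

definition sorted_svd ::
    "real^'n^'m \<Rightarrow> nat \<Rightarrow> (nat \<Rightarrow> real) \<Rightarrow> (nat \<Rightarrow> real^'m) \<Rightarrow> (nat \<Rightarrow> real^'n) \<Rightarrow> bool" where
  "sorted_svd X p s u v \<longleftrightarrow>
     (\<forall>k<p. 0 < s k) \<and> (\<forall>k\<ge>p. s k = 0) \<and> antimono s \<and>
     orthonormal_seq p u \<and> orthonormal_seq p v \<and>
     X = (\<Sum>k<p. s k *\<^sub>R outer (u k) (v k))"

lemma sorted_svdD:
  assumes "sorted_svd X p s u v"
  shows "k < p \<Longrightarrow> 0 < s k" "p \<le> k \<Longrightarrow> s k = 0" "0 \<le> s k" "i \<le> j \<Longrightarrow> s j \<le> s i"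
    "orthonormal_seq p u" "orthonormal_seq p v" "X = (\<Sum>k<p. s k *\<^sub>R outer (u k) (v k))"
proof -
  show "0 \<le> s k" using assms by (cases "k < p") (auto simp: sorted_svd_def intro: less_imp_le)
qed (use assms in \<open>auto simp: sorted_svd_def antimono_def\<close>)

text \<open>The right singular vectors are the eigenvectors with positive eigenvalue of the
  transpose of \<open>X\<close> times \<open>X\<close>, the left ones are their normalized images,
  and the singular values are the square roots of the eigenvalues.\<close>

lemma exists_sorted_svd:
  fixes X :: "real^'n^'m"
  obtains p s u v where "sorted_svd X p s u v"
proof -
  let ?n = "DIM(real^'n)"
  let ?f = "\<lambda>y. transpose X *v (X *v y)"
  have adj: "x \<bullet> (transpose X *v z) = (X *v x) \<bullet> z" for x :: "real^'n" and z
    by (metis dot_lmul_matrix inner_commute vector_transpose_matrix)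
  have lin: "linear ?f"
    by (rule linearI) (simp_all add: matrix_vector_right_distrib matrix_vector_mult_scaleR)
  have sym: "?f x \<bullet> y = x \<bullet> ?f y" for x y
    using adj[of y "X *v x"] adj[of x "X *v y"] by (simp only: inner_commute)
  obtain e l where e: "orthonormal_seq ?n e"
    and eig: "\<And>k. k < ?n \<Longrightarrow> ?f (e k) = l k *\<^sub>R e k"
    and anti: "\<And>i j. i \<le> j \<Longrightarrow> j < ?n \<Longrightarrow> l j \<le> (l i :: real)"
    using spectral_theorem[OF lin sym] by blast
  have Xe: "(X *v e i) \<bullet> (X *v e j) = (if i = j then l j else 0)" if "i < ?n" "j < ?n" for i j
    unfolding adj[symmetric] using eig[OF that(2)] orthonormal_seqD[OF e that] by simp
  \<comment> \<open>The eigenvalues are sorted, so \<open>p\<close> counts the positive ones. The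
    disjunct \<open>?n \<le> k\<close> gives the minimum a value when all of them are
    positive.\<close>
  define p where "p = (LEAST k. ?n \<le> k \<or> l k \<le> 0)"
  have p: "?n \<le> p \<or> l p \<le> 0" unfolding p_def by (rule LeastI[of _ ?n]) simp
  have lt_p: "k < ?n \<and> 0 < l k" if "k < p" for k
    using not_less_Least[OF that[unfolded p_def]] by auto
  have p_le: "p \<le> ?n" unfolding p_def by (rule Least_le) simp
  have ge_p: "X *v e k = 0" if "p \<le> k" "k < ?n" for k
  proof -
    have "(X *v e k) \<bullet> (X *v e k) \<le> 0"
      using Xe[OF that(2) that(2)] anti[OF that] p that by auto
    then show ?thesis by (metis inner_eq_zero_iff inner_ge_zero order_antisym)
  qed
  define s where "s k = (if k < p then sqrt (l k) else 0)" for k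
  define u where "u k = (1 / s k) *\<^sub>R (X *v e k)" for k
  have "sorted_svd X p s u e"
    unfolding sorted_svd_def
  proof (intro conjI)
    show "antimono s"
      using anti lt_p by (auto simp: antimono_def s_def less_imp_le)
    show "orthonormal_seq p u"
      using lt_p by (force simp: orthonormal_seq_def u_def Xe s_def)
    show "orthonormal_seq p e" using e p_le by (rule orthonormal_seq_mono)
    show "X = (\<Sum>k<p. s k *\<^sub>R outer (u k) (e k))"
    proof (unfold matrix_eq, intro allI)
      fix y
      have "X *v y = X *v (\<Sum>k<?n. (e k \<bullet> y) *\<^sub>R e k)"
        using orthonormal_seq_expand[of e y] e by simp
      also have "\<dots> = (\<Sum>k<?n. (e k \<bullet> y) *\<^sub>R (X *v e k))"
        by (simp add: linear_sum[OF matrix_vector_mul_linear] matrix_vector_mult_scaleR)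
      also have "\<dots> = (\<Sum>k<p. (e k \<bullet> y) *\<^sub>R (X *v e k))"
        by (rule sum.mono_neutral_right) (use p_le ge_p in auto)
      also have "\<dots> = (\<Sum>k<p. (s k * (e k \<bullet> y)) *\<^sub>R u k)"
        by (rule sum.cong) (use lt_p in \<open>force simp: u_def s_def\<close>)+
      finally show "X *v y = (\<Sum>k<p. s k *\<^sub>R outer (u k) (e k)) *v y"
        by (simp add: sum_outer_mult_vec)
    qed
  qed (use lt_p in \<open>auto simp: s_def\<close>)
  then show ?thesis by (rule that)
qed

section \<open>The nuclear norm as the sum of the singular values\<close>

text \<open>The coefficient of \<open>s k\<close> pairs the coordinates of \<open>u k\<close> along
  \<open>a\<close> with those of \<open>v k\<close> along \<open>b\<close>, hence is at most 1 by
  Bessel. This is one half of the variational formula for the nuclear norm.\<close>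

lemma sum_inner_orthonormal_le_sum_singular:
  assumes "orthonormal_seq p a" "orthonormal_seq p b" "orthonormal_seq q u" "orthonormal_seq q v"
    and "\<And>k. k < q \<Longrightarrow> 0 \<le> s k"
  shows "(\<Sum>i<p. a i \<bullet> ((\<Sum>k<q. s k *\<^sub>R outer (u k) (v k)) *v b i)) \<le> (\<Sum>k<q. s k)"
proof -
  have "(\<Sum>i<p. a i \<bullet> ((\<Sum>k<q. s k *\<^sub>R outer (u k) (v k)) *v b i))
      = (\<Sum>k<q. s k * (\<Sum>i<p. (a i \<bullet> u k) * (b i \<bullet> v k)))"
    unfolding inner_sum_outer_mult_vec
    by (subst sum.swap) (simp add: sum_distrib_left inner_commute mult_ac)
  also have "\<dots> \<le> (\<Sum>k<q. s k * 1)"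
  proof (intro sum_mono mult_left_mono)
    fix k assume "k \<in> {..<q}"
    then have "norm (u k) = 1" "norm (v k) = 1"
      using assms by (auto simp: orthonormal_seq_def norm_eq_1)
    then have "(\<Sum>i<p. \<bar>(a i \<bullet> u k) * (b i \<bullet> v k)\<bar>) \<le> 1"
      using bessel_inequality_product[OF assms(1,2), of "u k" "v k"] by simp
    then show "(\<Sum>i<p. (a i \<bullet> u k) * (b i \<bullet> v k)) \<le> 1"
      using sum_mono[of "{..<p}" "\<lambda>i. (a i \<bullet> u k) * (b i \<bullet> v k)"] by (smt (verit) abs_ge_self)
  qed (use assms in auto)
  finally show ?thesis by simp
qed

lemma inner_singular_vectors:
  assumes "orthonormal_seq p u" "orthonormal_seq p v" "k < p"
  shows "u k \<bullet> ((\<Sum>k<p. s k *\<^sub>R outer (u k) (v k)) *v v k) = s k"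
proof -
  have "u k \<bullet> ((\<Sum>k<p. s k *\<^sub>R outer (u k) (v k)) *v v k)
      = (\<Sum>j<p. if j = k then s k else 0)"
    unfolding inner_sum_outer_mult_vec
    by (rule sum.cong) (use assms in \<open>auto simp: orthonormal_seq_def\<close>)
  then show ?thesis using assms(3) by simp
qed

text \<open>Tested against its own singular vectors, a decomposition returns its total weight
  exactly; the variational bound compares this with the other decomposition. Exchanging the two
  gives equality.\<close>

lemma sum_singular_le_sum_singular:
  assumes "orthonormal_seq p a" "orthonormal_seq p b" "\<And>k. k < p \<Longrightarrow> 0 \<le> t k"
    and "orthonormal_seq q u" "orthonormal_seq q v" "\<And>k. k < q \<Longrightarrow> 0 \<le> s k"
    and "(\<Sum>k<p. t k *\<^sub>R outer (a k) (b k)) = (\<Sum>k<q. s k *\<^sub>R outer (u k) (v k))"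
  shows "(\<Sum>k<p. t k) \<le> (\<Sum>k<q. s k)"
proof -
  have "(\<Sum>k<p. t k) = (\<Sum>i<p. a i \<bullet> ((\<Sum>k<p. t k *\<^sub>R outer (a k) (b k)) *v b i))"
    using inner_singular_vectors[OF assms(1,2)] by simp
  also have "\<dots> \<le> (\<Sum>k<q. s k)"
    unfolding assms(7) by (rule sum_inner_orthonormal_le_sum_singular) (use assms in auto)
  finally show ?thesis .
qed

text \<open>\<open>nuc_norm\<close> picks its value by \<open>SOME\<close>, so besides existence all
  decompositions, sorted or not, must have the same sum.\<close>

lemma nuc_norm_eq:
  assumes svd: "sorted_svd X p s u v"
  shows "nuc_norm X = (\<Sum>k<p. s k)"
proof -
  note D = sorted_svdD[OF svd]
  let ?L = "map (\<lambda>k. (s k, u k, v k)) [0..<p]"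
  have "is_svd X ?L"
    using D(1) D(5,6) D(7) by (simp add: is_svd_def orthonormal_seq_def)
  moreover have "sum_list (map fst ?L) = (\<Sum>k<p. s k)"
    by (simp add: interv_sum_list_conv_sum_set_nat o_def atLeast0LessThan)
  moreover have "sum_list (map fst L) = (\<Sum>k<p. s k)" if L: "is_svd X L" for L
  proof -
    let ?s = "\<lambda>k. fst (L ! k)" and ?u = "\<lambda>k. fst (snd (L ! k))" and ?v = "\<lambda>k. snd (snd (L ! k))"
    have LD: "orthonormal_seq (length L) ?u" "orthonormal_seq (length L) ?v"
      "\<And>k. k < length L \<Longrightarrow> 0 \<le> ?s k" "X = (\<Sum>k<length L. ?s k *\<^sub>R outer (?u k) (?v k))"
      using L by (simp_all add: is_svd_def orthonormal_seq_def less_imp_le)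
    have eq: "(\<Sum>k<length L. ?s k *\<^sub>R outer (?u k) (?v k)) = (\<Sum>k<p. s k *\<^sub>R outer (u k) (v k))"
      using LD(4) D(7) by (rule trans[OF sym])
    have "sum_list (map fst L) = (\<Sum>k<length L. ?s k)"
      by (simp add: sum_list_sum_nth atLeast0LessThan)
    also have "(\<Sum>k<length L. ?s k) = (\<Sum>k<p. s k)"
    proof (rule antisym)
      show "(\<Sum>k<length L. ?s k) \<le> (\<Sum>k<p. s k)"
        by (rule sum_singular_le_sum_singular[OF LD(1,2) _ D(5,6,3) eq]) (rule LD(3))
      show "(\<Sum>k<p. s k) \<le> (\<Sum>k<length L. ?s k)"
        by (rule sum_singular_le_sum_singular[OF D(5,6,3) LD(1,2) _ eq[symmetric]]) (rule LD(3))
    qed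
    finally show ?thesis .
  qed
  ultimately show ?thesis
    unfolding nuc_norm_def by (intro some_equality) metis+
qed

lemma sorted_svd_rank:
  assumes svd: "sorted_svd X p s u v"
  shows "p = rank X"
proof (rule antisym)
  note D = sorted_svdD[OF svd]
  have "u k \<in> range ((*v) X)" if "k < p" for k
  proof -
    have "X *v v k = (\<Sum>j<p. (if j = k then s k else 0) *\<^sub>R u j)"
      unfolding D(7) sum_outer_mult_vec
      by (rule sum.cong) (use D(6) that in \<open>auto simp: orthonormal_seq_def\<close>)
    also have "\<dots> = s k *\<^sub>R u k"
      using that by (simp add: if_distrib[of "\<lambda>c. c *\<^sub>R _"] cong: if_cong)
    finally have "X *v ((1 / s k) *\<^sub>R v k) = u k"
      using D(1)[OF that] by (simp add: matrix_vector_mult_scaleR)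
    then show ?thesis by (metis rangeI)
  qed
  then have "dim (u ` {..<p}) \<le> dim (range ((*v) X))"
    by (intro dim_subset) auto
  then show "p \<le> rank X"
    using dim_orthonormal_seq[OF D(5) subset_refl] by (simp add: rank_dim_range)
  show "rank X \<le> p"
    using rank_sum_outer_le[of "{..<p}" s u v] D(7) by simp
qed

section \<open>Weighted sums\<close>

text \<open>Weights in \<open>[0, S]\<close> of total at most \<open>k * S\<close> do best with
  \<open>S\<close> on the largest nonnegative coefficients, at most \<open>k\<close> of them. By
  linear programming duality \<open>\<theta>\<close> is the multiplier of the total weight, and
  \<open>\<theta> = 0 \<or> card T = k\<close> is complementary slackness.\<close>

lemma sum_mult_le_threshold:
  fixes c w :: "'i \<Rightarrow> real"
  assumes "finite I" "T \<subseteq> I" "\<And>j. j \<in> T \<Longrightarrow> \<theta> \<le> c j" "\<And>j. j \<in> I - T \<Longrightarrow> c j \<le> \<theta>"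
    and "0 \<le> \<theta>" "\<theta> = 0 \<or> card T = k"
    and w: "\<And>j. j \<in> I \<Longrightarrow> 0 \<le> w j" "\<And>j. j \<in> I \<Longrightarrow> w j \<le> S" "(\<Sum>j\<in>I. w j) \<le> real k * S"
  shows "(\<Sum>j\<in>I. w j * c j) \<le> S * (\<Sum>j\<in>T. c j)"
proof -
  have split: "(\<Sum>j\<in>I. g j) = (\<Sum>j\<in>I - T. g j) + (\<Sum>j\<in>T. g j)" for g :: "'i \<Rightarrow> real"
    using assms(1,2) by (simp add: sum.subset_diff)
  have "(\<Sum>j\<in>I - T. w j * c j) \<le> (\<Sum>j\<in>I - T. w j * \<theta>)"
    by (intro sum_mono mult_left_mono) (use assms in auto)
  also have "\<dots> = ((\<Sum>j\<in>I. w j) - (\<Sum>j\<in>T. w j)) * \<theta>"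
    by (simp add: split[of w] sum_distrib_right)
  also have "\<dots> \<le> (real k * S - (\<Sum>j\<in>T. w j)) * \<theta>"
    using w(3) assms(5) by (intro mult_right_mono) auto
  also have "\<dots> = real (card T) * S * \<theta> - (\<Sum>j\<in>T. w j * \<theta>)"
    using assms(6) by (auto simp: left_diff_distrib sum_distrib_right)
  finally have 1: "(\<Sum>j\<in>I - T. w j * c j) \<le> real (card T) * S * \<theta> - (\<Sum>j\<in>T. w j * \<theta>)" .
  \<comment> \<open>Raising a weight on \<open>T\<close> to \<open>S\<close> gains at least
    \<open>\<theta>\<close> per unit, which pays for the weight given up outside
    \<open>T\<close>.\<close>
  have "0 \<le> (\<Sum>j\<in>T. (c j - \<theta>) * (S - w j))"
    by (intro sum_nonneg mult_nonneg_nonneg) (use assms in auto)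
  also have "\<dots> = (\<Sum>j\<in>T. c j * S) - (\<Sum>j\<in>T. w j * c j) - real (card T) * S * \<theta> + (\<Sum>j\<in>T. w j * \<theta>)"
    by (simp add: algebra_simps sum_subtractf sum.distrib)
  also have "(\<Sum>j\<in>T. c j * S) = S * (\<Sum>j\<in>T. c j)"
    by (simp add: sum_distrib_left mult.commute)
  finally show ?thesis
    using 1 split[of "\<lambda>j. w j * c j"] by linarith
qed

text \<open>Greedy selection: the largest remaining coefficient joins \<open>T\<close> and becomes
  the threshold, until no positive one remains; from then on \<open>\<theta> = 0\<close> and
  \<open>T\<close> stays.\<close>

lemma exists_top_subset:
  fixes c :: "'i \<Rightarrow> real"
  assumes "finite I"
  shows "\<exists>T \<theta>. T \<subseteq> I \<and> card T \<le> k \<and> (\<forall>j\<in>T. \<theta> \<le> c j) \<and> (\<forall>j\<in>I - T. c j \<le> \<theta>) \<and>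
    0 \<le> \<theta> \<and> (\<theta> = 0 \<or> card T = k)"
proof (induction k)
  case 0
  have "c j \<le> (\<Sum>i\<in>I. \<bar>c i\<bar>)" if "j \<in> I" for j
    using member_le_sum[of j I "\<lambda>i. \<bar>c i\<bar>"] assms that by force
  \<comment> \<open>With \<open>T\<close> empty the threshold only has to be nonnegative and
    dominate every coefficient.\<close>
  then show ?case by (intro exI[of _ "{}"] exI[of _ "\<Sum>i\<in>I. \<bar>c i\<bar>"]) (auto intro: sum_nonneg)
next
  case (Suc k)
  then obtain T \<theta> where T: "T \<subseteq> I" "card T \<le> k" "\<forall>j\<in>T. \<theta> \<le> c j" "\<forall>j\<in>I - T. c j \<le> \<theta>"
    "0 \<le> \<theta>" "\<theta> = 0 \<or> card T = k" by blast
  show ?case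
  proof (cases "\<theta> = 0 \<or> (\<forall>j\<in>I - T. c j \<le> 0)")
    case True
    then show ?thesis using T by (intro exI[of _ T] exI[of _ 0]) auto
  next
    case False
    then obtain i where i: "i \<in> I - T" "0 < c i" and k: "card T = k" using T(6) by force
    have fin: "finite (c ` (I - T))" using assms by simp
    have "Max (c ` (I - T)) \<in> c ` (I - T)" using fin i(1) by (intro Max_in) auto
    then obtain j where j: "j \<in> I - T" "c j = Max (c ` (I - T))" by force
    have le: "c l \<le> c j" if "l \<in> I - T" for l using fin that by (simp add: j(2))
    have "finite T" using T(1) assms finite_subset by blast
    then have "card (insert j T) = Suc k" using j(1) k by simp
    then show ?thesis
      using T j(1) le less_le_trans[OF i(2) le[OF i(1)]]
      by (intro exI[of _ "insert j T"] exI[of _ "c j"]) (auto intro: order_trans)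
  qed
qed

text \<open>In a sorted sequence the best positions are the first \<open>r\<close>. The threshold is
  \<open>s r\<close>, which is 0 by padding when \<open>p \<le> r\<close>.\<close>

lemma sorted_svd_weighted_sum_le:
  assumes svd: "sorted_svd X p s u v"
    and w: "\<And>j. j < p \<Longrightarrow> 0 \<le> w j" "\<And>j. j < p \<Longrightarrow> w j \<le> S" "(\<Sum>j<p. w j) \<le> real r * S"
  shows "(\<Sum>j<p. w j * s j) \<le> S * (\<Sum>j<r. s j)"
proof -
  note D = sorted_svdD[OF svd]
  have "(\<Sum>j<p. w j * s j) \<le> S * (\<Sum>j<min r p. s j)"
  proof (rule sum_mult_le_threshold[where \<theta> = "s r"])
    show "s r = 0 \<or> card {..<min r p} = r" using D(2)[of r] by auto
  qed (use w in \<open>auto intro: D(3) D(4)\<close>)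
  also have "(\<Sum>j<min r p. s j) = (\<Sum>j<r. s j)"
    by (rule sum.mono_neutral_left) (auto intro!: D(2))
  finally show ?thesis .
qed

section \<open>A perturbation bound for the nuclear norm\<close>

text \<open>
  The eigenvectors of the self-adjoint dilation \<open>(x, y) \<mapsto> (X y, X\<^sup>T x)\<close> for the eigenvalues
  \<open>s k\<close> and \<open>- s k\<close>; its quadratic form at \<open>z\<close> is \<open>2 * (fst z \<bullet> (X *v snd z))\<close>.
\<close>

definition pair_plus :: "(nat \<Rightarrow> 'a::real_vector) \<Rightarrow> (nat \<Rightarrow> 'b::real_vector) \<Rightarrow> nat \<Rightarrow> 'a \<times> 'b" where
  "pair_plus u v k = (1 / sqrt 2) *\<^sub>R (u k, v k)"

definition pair_minus :: "(nat \<Rightarrow> 'a::real_vector) \<Rightarrow> (nat \<Rightarrow> 'b::real_vector) \<Rightarrow> nat \<Rightarrow> 'a \<times> 'b" where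
  "pair_minus u v k = (1 / sqrt 2) *\<^sub>R (u k, - v k)"

lemma orthonormal_seq_pair:
  assumes "orthonormal_seq p u" "orthonormal_seq p v"
  shows "orthonormal_seq p (pair_plus u v)" "orthonormal_seq p (pair_minus u v)"
    and "i < p \<Longrightarrow> j < p \<Longrightarrow> pair_minus u v i \<bullet> pair_plus u v j = 0"
  using assms
  by (auto simp: orthonormal_seq_def pair_plus_def pair_minus_def inner_prod_def)

text \<open>Polarizing each product yields the spectral decomposition of the dilation form.\<close>

lemma dilation_form_eq:
  "2 * (fst z \<bullet> ((\<Sum>k<p. s k *\<^sub>R outer (u k) (v k)) *v snd z))
    = (\<Sum>k<p. s k * ((pair_plus u v k \<bullet> z)\<^sup>2 - (pair_minus u v k \<bullet> z)\<^sup>2))"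
proof -
  have "(pair_plus u v k \<bullet> z)\<^sup>2 - (pair_minus u v k \<bullet> z)\<^sup>2 = 2 * (u k \<bullet> fst z) * (v k \<bullet> snd z)" for k
    by (simp add: pair_plus_def pair_minus_def inner_prod_def power_divide field_simps)
      (simp add: power2_eq_square algebra_simps)
  then show ?thesis
    unfolding inner_sum_outer_mult_vec by (simp add: sum_distrib_left mult_ac)
qed

text \<open>On this span the \<open>pair_minus\<close> coordinates vanish and every weight that
  occurs is at least \<open>s k\<close>. It is the test space of dimension \<open>k + 1\<close> for
  the large eigenvalues.\<close>

lemma dilation_form_ge_on_top_span:
  assumes svd: "sorted_svd X p s u v" and k: "k < p" and z: "z \<in> span (pair_plus u v ` {..k})"
  shows "s k * (z \<bullet> z) \<le> 2 * (fst z \<bullet> (X *v snd z))"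
proof -
  note D = sorted_svdD[OF svd]
  note P = orthonormal_seq_pair[OF D(5,6)]
  have I: "{..k} \<subseteq> {..<p}" using k by auto
  obtain c where c: "z = (\<Sum>j\<in>{..k}. c j *\<^sub>R pair_plus u v j)"
    using orthonormal_seq_span[OF P(1) I z] by blast
  have minus: "pair_minus u v l \<bullet> z = 0" if "l < p" for l
    unfolding c inner_sum_right using P(3)[OF that] k by (auto intro!: sum.neutral)
  have plus: "pair_plus u v l \<bullet> z = (if l \<in> {..k} then c l else 0)" if "l < p" for l
    unfolding c by (rule orthonormal_seq_inner_sum[OF P(1) I that])
  have "s k * (z \<bullet> z) = (\<Sum>l\<in>{..k}. s k * (c l)\<^sup>2)"
    unfolding c orthonormal_seq_inner_sum_sum[OF P(1) I]
    by (simp add: sum_distrib_left power2_eq_square)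
  also have "\<dots> \<le> (\<Sum>l\<in>{..k}. s l * (c l)\<^sup>2)"
    by (intro sum_mono mult_right_mono) (auto intro: D(4))
  also have "\<dots> = (\<Sum>l<p. s l * (if l \<in> {..k} then c l else 0)\<^sup>2)"
    by (rule sum.mono_neutral_cong_left) (use I in auto)
  also have "\<dots> = (\<Sum>l<p. s l * ((pair_plus u v l \<bullet> z)\<^sup>2 - (pair_minus u v l \<bullet> z)\<^sup>2))"
    by (rule sum.cong) (use plus minus in auto)
  also have "\<dots> = 2 * (fst z \<bullet> (X *v snd z))"
    unfolding D(7) dilation_form_eq ..
  finally show ?thesis .
qed

text \<open>Orthogonality to the first \<open>j\<close> of the \<open>pair_minus\<close> vectors
  leaves no negative weight below \<open>- s j\<close>, and Bessel bounds the remaining coordinates.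
  For \<open>p \<le> j\<close> the form is nonnegative.\<close>

lemma dilation_form_ge_on_complement:
  assumes svd: "sorted_svd X p s u v" and z: "\<And>l. l < j \<Longrightarrow> pair_minus u v l \<bullet> z = 0"
  shows "- s j * (z \<bullet> z) \<le> 2 * (fst z \<bullet> (X *v snd z))"
proof -
  note D = sorted_svdD[OF svd]
  note P = orthonormal_seq_pair[OF D(5,6)]
  have "- s j * (z \<bullet> z) \<le> - s j * (\<Sum>l<p. (pair_minus u v l \<bullet> z)\<^sup>2)"
    using mult_left_mono[OF bessel_inequality[OF P(2), of z] D(3)[of j]] by simp
  also have "\<dots> = (\<Sum>l<p. - s j * (pair_minus u v l \<bullet> z)\<^sup>2)"
    by (rule sum_distrib_left)
  also have "\<dots> \<le> (\<Sum>l<p. s l * ((pair_plus u v l \<bullet> z)\<^sup>2 - (pair_minus u v l \<bullet> z)\<^sup>2))"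
  proof (rule sum_mono)
    fix l assume "l \<in> {..<p}"
    have "s l * (pair_minus u v l \<bullet> z)\<^sup>2 \<le> s j * (pair_minus u v l \<bullet> z)\<^sup>2"
      using z[of l] D(4)[of j l] by (cases "l < j") (auto intro: mult_right_mono)
    moreover have "0 \<le> s l * (pair_plus u v l \<bullet> z)\<^sup>2" using D(3)[of l] by simp
    ultimately show "- s j * (pair_minus u v l \<bullet> z)\<^sup>2
        \<le> s l * ((pair_plus u v l \<bullet> z)\<^sup>2 - (pair_minus u v l \<bullet> z)\<^sup>2)"
      by (simp add: algebra_simps)
  qed
  also have "\<dots> = 2 * (fst z \<bullet> (X *v snd z))"
    unfolding D(7) dilation_form_eq ..
  finally show ?thesis .
qed

lemma orthonormal_seq_le_DIM:
  fixes e :: "nat \<Rightarrow> 'a::euclidean_space"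
  assumes "orthonormal_seq n e"
  shows "n \<le> DIM('a)"
  using dim_orthonormal_seq[OF assms subset_refl] dim_subset_UNIV[of "e ` {..<n}"] by simp

text \<open>
  The operator \<open>f\<close> below is the dilation of \<open>X\<close> plus the positive part of the dilation of \<open>G - X\<close>. It
  dominates the dilations of both \<open>X\<close> and \<open>G\<close>, and its trace is the nuclear norm of \<open>G - X\<close>, so each of
  its eigenvalues can be bounded below through whichever of \<open>X\<close> and \<open>G\<close> is better.
\<close>

lemma nuc_norm_diff_ge:
  fixes X G :: "real^'n^'m"
  assumes X: "sorted_svd X p s u v" and G: "sorted_svd G q t a b"
  shows "(\<Sum>k<p. s k) + (\<Sum>k<q. t k) - 2 * (\<Sum>k<p. t k) \<le> nuc_norm (G - X)"
proof -
  note XD = sorted_svdD[OF X] and GD = sorted_svdD[OF G]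
  obtain m y c d where Y: "sorted_svd (G - X) m y c d" by (rule exists_sorted_svd)
  note YD = sorted_svdD[OF Y]
  let ?N = "DIM((real^'m) \<times> (real^'n))"
  define P M where "P = pair_plus u v" and "M = pair_minus u v"
  define Q R where "Q = pair_plus c d" and "R = pair_minus c d"
  have P: "orthonormal_seq p P" "orthonormal_seq p M"
    unfolding P_def M_def by (rule orthonormal_seq_pair[OF XD(5,6)])+
  have Q: "orthonormal_seq m Q"
    unfolding Q_def by (rule orthonormal_seq_pair[OF YD(5,6)])
  define f where "f z = (\<Sum>k<p. s k *\<^sub>R ((P k \<bullet> z) *\<^sub>R P k - (M k \<bullet> z) *\<^sub>R M k))
      + (\<Sum>k<m. y k *\<^sub>R (Q k \<bullet> z) *\<^sub>R Q k)" for z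
  have lin: "linear f"
    by (rule linearI)
      (simp_all add: f_def inner_add_right algebra_simps sum.distrib sum_subtractf scaleR_sum_right)
  have sym: "f z \<bullet> z' = z \<bullet> f z'" for z z'
    by (simp add: f_def inner_add_left inner_add_right inner_sum_left inner_sum_right
        inner_diff_left inner_diff_right inner_commute mult_ac)
  have form: "f z \<bullet> z = 2 * (fst z \<bullet> (X *v snd z)) + (\<Sum>k<m. y k * (Q k \<bullet> z)\<^sup>2)" for z
    unfolding XD(7) dilation_form_eq P_def[symmetric] M_def[symmetric]
    by (simp add: f_def inner_add_left inner_sum_left inner_diff_left power2_eq_square mult.assoc)
  have form_ge_X: "2 * (fst z \<bullet> (X *v snd z)) \<le> f z \<bullet> z" for z
    unfolding form using YD(3) by (simp add: sum_nonneg)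
  have form_ge_G: "2 * (fst z \<bullet> (G *v snd z)) \<le> f z \<bullet> z" for z
  proof -
    have "2 * (fst z \<bullet> ((G - X) *v snd z)) = (\<Sum>k<m. y k * ((Q k \<bullet> z)\<^sup>2 - (R k \<bullet> z)\<^sup>2))"
      unfolding YD(7) dilation_form_eq Q_def R_def ..
    also have "\<dots> \<le> (\<Sum>k<m. y k * (Q k \<bullet> z)\<^sup>2)"
      by (intro sum_mono mult_left_mono) (use YD(3) in auto)
    finally show ?thesis
      unfolding form by (simp add: matrix_vector_mult_diff_rdistrib inner_diff_right)
  qed
  obtain e l where e: "orthonormal_seq ?N e"
    and eig: "\<And>k. k < ?N \<Longrightarrow> f (e k) = l k *\<^sub>R e k"
    and anti: "\<And>i j. i \<le> j \<Longrightarrow> j < ?N \<Longrightarrow> l j \<le> (l i :: real)"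
    using spectral_theorem[OF lin sym] by blast
  have courant: "c' \<le> l k" if "k < ?N" "subspace S" "k < dim S"
    "\<And>z. z \<in> S \<Longrightarrow> c' * (z \<bullet> z) \<le> f z \<bullet> z" for c' k S
    using that by (intro courant_fischer_lower_bound[OF lin e, of l k S c'] eig anti)
  \<comment> \<open>By Parseval each projection onto a unit vector has trace 1, so the
    \<open>P\<close> and \<open>M\<close> terms cancel and only the \<open>y k\<close>
    remain.\<close>
  have trace: "(\<Sum>k<?N. l k) = nuc_norm (G - X)"
  proof -
    have parseval: "(\<Sum>k<?N. (w \<bullet> e k)\<^sup>2) = 1" if "w \<bullet> w = 1" for w
      using parseval_identity[OF e, of w] that by (simp only: inner_commute)
    have norms: "k < p \<Longrightarrow> (\<Sum>i<?N. (P k \<bullet> e i)\<^sup>2) = 1" "k < p \<Longrightarrow> (\<Sum>i<?N. (M k \<bullet> e i)\<^sup>2) = 1"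
      "k < m \<Longrightarrow> (\<Sum>i<?N. (Q k \<bullet> e i)\<^sup>2) = 1" for k
      by (intro parseval, use P Q in \<open>simp add: orthonormal_seq_def\<close>)+
    have "(\<Sum>k<?N. l k) = (\<Sum>k<?N. f (e k) \<bullet> e k)"
      by (rule sum.cong) (use eig orthonormal_seqD[OF e] in auto)
    also have "\<dots> = (\<Sum>i<?N. \<Sum>k<p. s k * ((P k \<bullet> e i)\<^sup>2 - (M k \<bullet> e i)\<^sup>2))
        + (\<Sum>i<?N. \<Sum>k<m. y k * (Q k \<bullet> e i)\<^sup>2)"
      unfolding form XD(7) dilation_form_eq P_def[symmetric] M_def[symmetric]
      by (rule sum.distrib)
    also have "\<dots> = (\<Sum>k<p. s k * ((\<Sum>i<?N. (P k \<bullet> e i)\<^sup>2) - (\<Sum>i<?N. (M k \<bullet> e i)\<^sup>2)))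
        + (\<Sum>k<m. y k * (\<Sum>i<?N. (Q k \<bullet> e i)\<^sup>2))"
      unfolding sum_subtractf[symmetric] sum_distrib_left
      by (intro arg_cong2[of _ _ _ _ "(+)"] sum.swap)
    also have "\<dots> = (\<Sum>k<p. s k * (1 - 1)) + (\<Sum>k<m. y k * 1)"
      by (intro arg_cong2[of _ _ _ _ "(+)"] sum.cong refl) (simp_all only: lessThan_iff norms)
    finally show ?thesis using nuc_norm_eq[OF Y] by simp
  qed
  have "p \<le> DIM(real^'m)" "p \<le> DIM(real^'n)" "q \<le> DIM(real^'m)" "q \<le> DIM(real^'n)"
    using orthonormal_seq_le_DIM XD(5,6) GD(5,6) by blast+
  \<comment> \<open>The first and the last \<open>p\<close> indices form disjoint blocks, and every
    nonzero \<open>t k\<close> lies before the last block.\<close>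
  then have pq: "2 * p \<le> ?N" "p + q \<le> ?N" by auto
  have top: "s' k \<le> l k"
    if svd: "sorted_svd Z p' s' u' v'" and ge: "\<And>z. 2 * (fst z \<bullet> (Z *v snd z)) \<le> f z \<bullet> z"
      and k: "k < p'" "k < ?N" for Z :: "real^'n^'m" and p' s' u' v' k
  proof (rule courant[OF k(2)])
    let ?S = "span (pair_plus u' v' ` {..k})"
    have "{..k} \<subseteq> {..<p'}" using k by auto
    then have "dim ?S = Suc k"
      using dim_orthonormal_seq[OF orthonormal_seq_pair(1)[OF sorted_svdD(5,6)[OF svd]], of "{..k}"]
      by simp
    then show "k < dim ?S" by simp
    show "s' k * (z \<bullet> z) \<le> f z \<bullet> z" if "z \<in> ?S" for z
      using dilation_form_ge_on_top_span[OF svd k(1) that] ge[of z] by simp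
  qed auto
  have bottom: "- s' j \<le> l k"
    if svd: "sorted_svd Z p' s' u' v'" and ge: "\<And>z. 2 * (fst z \<bullet> (Z *v snd z)) \<le> f z \<bullet> z"
      and k: "k + j < ?N" for Z :: "real^'n^'m" and p' s' u' v' k j
  proof -
    let ?S = "{z. \<forall>l<j. pair_minus u' v' l \<bullet> z = 0}"
    have "k < ?N" using k by simp
    then show ?thesis
    proof (rule courant[OF _ dim_orthogonal_complement_ge(2)])
      show "k < dim ?S"
        using dim_orthogonal_complement_ge(1)[of j "pair_minus u' v'"] k by linarith
      show "- s' j * (z \<bullet> z) \<le> f z \<bullet> z" if "z \<in> ?S" for z
        using dilation_form_ge_on_complement[OF svd, of j z] ge[of z] that by simp
    qed
  qed
  \<comment> \<open>The trace is bounded blockwise: by \<open>s\<close> on the first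
    \<open>p\<close> indices, by \<open>t\<close> on the middle ones, and by reflected values of
    \<open>- t\<close> on the last \<open>p\<close>.\<close>
  have 1: "(\<Sum>k<p. s k) \<le> (\<Sum>k<p. l k)"
    by (rule sum_mono) (use pq top[OF X form_ge_X] in auto)
  have 2: "(\<Sum>k=p..<?N - p. t k) \<le> (\<Sum>k=p..<?N - p. l k)"
  proof (rule sum_mono)
    \<comment> \<open>From \<open>q\<close> on \<open>t k = 0\<close>, and \<open>X\<close> supplies
      the bound: with \<open>j = p\<close> its form is bounded below through
      \<open>- s p = 0\<close>.\<close>
    fix k assume "k \<in> {p..<?N - p}"
    then show "t k \<le> l k"
      using top[OF G form_ge_G, of k] bottom[OF X form_ge_X, of k p] XD(2)[of p] GD(2)[of k]
      by (cases "k < q") auto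
  qed
  \<comment> \<open>The index \<open>?N - 1 - k\<close> is the largest \<open>j\<close> with
    \<open>k + j < ?N\<close>, as \<open>bottom\<close> requires.\<close>
  have "- (\<Sum>k<p. t k) = (\<Sum>k=?N - p..<?N. - t (?N - 1 - k))"
    unfolding sum_negf[symmetric]
    by (rule sum.reindex_bij_witness[of _ "\<lambda>k. ?N - 1 - k" "\<lambda>k. ?N - 1 - k"]) (use pq in auto)
  also have "\<dots> \<le> (\<Sum>k=?N - p..<?N. l k)"
    by (rule sum_mono) (rule bottom[OF G form_ge_G], auto)
  finally have 3: "- (\<Sum>k<p. t k) \<le> (\<Sum>k=?N - p..<?N. l k)" .
  have split: "(\<Sum>k<i. g k) + (\<Sum>k=i..<j. g k) = (\<Sum>k<j. g k)" if "i \<le> j" for i j and g :: "nat \<Rightarrow> real"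
    using sum.atLeastLessThan_concat[of 0 i j g] that by (simp add: atLeast0LessThan)
  have "(\<Sum>k<?N - p. t k) = (\<Sum>k<q. t k)"
    by (rule sum.mono_neutral_right) (use pq GD(2) in auto)
  then show ?thesis
    using 1 2 3 split[of p "?N - p" t] split[of p "?N - p" l] split[of "?N - p" ?N l] pq trace
    by linarith
qed

lemma outer_uminus_left: "outer (- a) b = - outer a b"
  by (simp add: outer_def vec_eq_iff)

text \<open>The perturbation bound speaks of a difference; moving the sign into the left singular
  vectors makes it apply to a sum.\<close>

lemma sorted_svd_uminus:
  assumes "sorted_svd X p s u v"
  shows "sorted_svd (- X) p s (\<lambda>k. - u k) v"
  using assms by (simp add: sorted_svd_def orthonormal_seq_def sum_negf outer_uminus_left)

section \<open>Inner products bounded by the spectral norm\<close>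

lemma singular_value_le_spec_norm:
  assumes svd: "sorted_svd X p s u v" and k: "k < p"
  shows "s k \<le> spec_norm X"
proof -
  note D = sorted_svdD[OF svd]
  have n: "norm (u k) = 1" "norm (v k) = 1"
    using orthonormal_seqD[OF D(5) k k] orthonormal_seqD[OF D(6) k k] by (simp_all add: norm_eq_1)
  have "s k = u k \<bullet> (X *v v k)"
    unfolding D(7) using inner_singular_vectors[OF D(5,6) k] by simp
  also have "\<dots> \<le> norm (u k) * norm (X *v v k)" by (rule norm_cauchy_schwarz)
  also have "\<dots> \<le> spec_norm X"
    using onorm[OF matrix_vector_mul_bounded_linear, of X "v k"] n by (simp add: spec_norm_def)
  finally show ?thesis .
qed

text \<open>Expanding both decompositions bounds the inner product by a weighted sum of the
  \<open>t j\<close>. Bessel over \<open>i\<close> caps each weight by \<open>spec_norm X\<close>,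
  and Bessel over \<open>j\<close> caps their total by \<open>p\<close> times that, so the sorted
  weight bound applies.\<close>

lemma abs_inner_le_spec_norm_ky_fan:
  assumes X: "sorted_svd X p s u v" and H: "sorted_svd H q t a b" and pr: "p \<le> r"
  shows "\<bar>X \<bullet> H\<bar> \<le> spec_norm X * (\<Sum>j<r. t j)"
proof -
  note XD = sorted_svdD[OF X] and HD = sorted_svdD[OF H]
  define S where "S = spec_norm X"
  have S0: "0 \<le> S" unfolding S_def spec_norm_def by (intro onorm_pos_le) auto
  have sS: "s i \<le> S" if "i < p" for i
    using singular_value_le_spec_norm[OF X that] by (simp add: S_def)
  define W where "W j = (\<Sum>i<p. s i * \<bar>(u i \<bullet> a j) * (v i \<bullet> b j)\<bar>)" for j
  have nHa: "norm (a j) = 1" "norm (b j) = 1" if "j < q" for j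
    using orthonormal_seqD[OF HD(5) that that] orthonormal_seqD[OF HD(6) that that]
    by (simp_all add: norm_eq_1)
  have nXu: "norm (u i) = 1" "norm (v i) = 1" if "i < p" for i
    using orthonormal_seqD[OF XD(5) that that] orthonormal_seqD[OF XD(6) that that]
    by (simp_all add: norm_eq_1)
  have W0: "0 \<le> W j" for j unfolding W_def using XD(3) by (intro sum_nonneg mult_nonneg_nonneg) auto
  have WS: "W j \<le> S" if "j < q" for j
  proof -
    have "W j \<le> (\<Sum>i<p. S * \<bar>(u i \<bullet> a j) * (v i \<bullet> b j)\<bar>)"
      unfolding W_def by (intro sum_mono mult_right_mono) (use sS in auto)
    also have "\<dots> \<le> S * 1"
      unfolding sum_distrib_left[symmetric] using S0
      by (intro mult_left_mono)
        (use bessel_inequality_product[OF XD(5,6), of "a j" "b j"] nHa[OF that] in auto)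
    finally show ?thesis by simp
  qed
  have "(\<Sum>j<q. W j) = (\<Sum>i<p. s i * (\<Sum>j<q. \<bar>(a j \<bullet> u i) * (b j \<bullet> v i)\<bar>))"
    unfolding W_def by (subst sum.swap) (simp add: sum_distrib_left inner_commute)
  also have "\<dots> \<le> (\<Sum>i<p. S * 1)"
  proof (intro sum_mono mult_mono)
    fix i assume "i \<in> {..<p}"
    then show "(\<Sum>j<q. \<bar>(a j \<bullet> u i) * (b j \<bullet> v i)\<bar>) \<le> 1"
      using bessel_inequality_product[OF HD(5,6), of "u i" "v i"] nXu[of i] by simp
  qed (use sS S0 in \<open>auto intro: sum_nonneg\<close>)
  also have "\<dots> \<le> real r * S" using pr S0 by (simp add: mult_right_mono)
  finally have Wsum: "(\<Sum>j<q. W j) \<le> real r * S" .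
  have "X \<bullet> H = (\<Sum>i<p. s i * (u i \<bullet> (H *v v i)))"
    unfolding inner_commute[of X] by (subst XD(7)) (simp add: inner_sum_right inner_outer)
  also have "\<dots> = (\<Sum>j<q. t j * (\<Sum>i<p. s i * ((u i \<bullet> a j) * (v i \<bullet> b j))))"
    unfolding HD(7) inner_sum_outer_mult_vec sum_distrib_left
    by (subst sum.swap) (simp add: inner_commute mult_ac)
  also have "\<bar>\<dots>\<bar> \<le> (\<Sum>j<q. W j * t j)"
  proof (rule order.trans[OF sum_abs sum_mono])
    fix j
    have le: "\<bar>\<Sum>i<p. s i * ((u i \<bullet> a j) * (v i \<bullet> b j))\<bar> \<le> W j"
      unfolding W_def
      by (rule order.trans[OF sum_abs]) (use XD(3) in \<open>simp add: abs_mult\<close>)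
    show "\<bar>t j * (\<Sum>i<p. s i * ((u i \<bullet> a j) * (v i \<bullet> b j)))\<bar> \<le> W j * t j"
      using mult_left_mono[OF le HD(3)[of j]] HD(3)[of j]
      by (simp only: abs_mult abs_of_nonneg mult.commute[of "W j"])
  qed
  also have "\<dots> \<le> S * (\<Sum>j<r. t j)"
    by (rule sorted_svd_weighted_sum_le[OF H W0 WS Wsum])
  finally show ?thesis by (simp add: S_def)
qed

section \<open>Restricted isometry\<close>

text \<open>The condition on \<open>\<delta>\<close> is
  \<open>\<delta> * (1 + \<kappa>\<^sup>2) / 2 < 1 - \<delta>\<close> rearranged. In the assumed
  counterexample \<open>\<kappa>\<close> bounds the ratio of the tail sum to the head sum.\<close>

lemma rip_null_space_property:
  fixes A :: "real^'n^'m \<Rightarrow> 'b::real_inner"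
  assumes lin: "linear A" and \<delta>: "0 \<le> \<delta>" "\<delta> * (3 + \<kappa>\<^sup>2) < 2" and \<kappa>: "1 \<le> \<kappa>"
    and rip: "\<And>X. rank X \<le> 2 * r \<Longrightarrow>
      (1 - \<delta>) * (norm X)\<^sup>2 \<le> (norm (A X))\<^sup>2 \<and> (norm (A X))\<^sup>2 \<le> (1 + \<delta>) * (norm X)\<^sup>2"
    and H: "sorted_svd H q t a b" "A H = 0" "H \<noteq> 0" and r: "0 < r"
  shows "(1 + \<kappa>) * (\<Sum>j<r. t j) < (\<Sum>j<q. t j)"
proof (rule ccontr)
  assume "\<not> ?thesis"
  then have tail_le: "(\<Sum>j<q. t j) \<le> (1 + \<kappa>) * (\<Sum>j<r. t j)" by simp
  note D = sorted_svdD[OF H(1)]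
  define E where "E j = outer (a j) (b j)" for j
  have E: "orthonormal_seq q E" unfolding E_def by (rule orthonormal_seq_outer[OF D(5,6)])
  define S where "S = (\<Sum>j<r. t j)"
  define J where "J = {..<min r q}"
  define I where "I = {r..<q}"
  \<comment> \<open>The tail sum is at most \<open>\<kappa> * S = r * B\<close>. Each tail value is
    at most the head average \<open>S / r\<close>, hence at most \<open>B\<close> as
    \<open>1 \<le> \<kappa>\<close>.\<close>
  define B where "B = \<kappa> * S / real r"
  have JI: "J \<union> I = {..<q}" "J \<inter> I = {}" "finite J" "finite I" "J \<subseteq> {..<r}"
    unfolding J_def I_def by auto
  have splitJI: "(\<Sum>j<q. g j) = (\<Sum>j\<in>J. g j) + (\<Sum>j\<in>I. g j)" for g :: "nat \<Rightarrow> 'c::comm_monoid_add"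
    using sum.union_disjoint[OF JI(3,4,2), of g] by (simp only: JI(1))
  have S_J: "S = (\<Sum>j\<in>J. t j)"
    unfolding S_def J_def by (rule sum.mono_neutral_right) (auto intro!: D(2))
  have S0: "0 \<le> S" unfolding S_def by (intro sum_nonneg D(3))
  have t_le: "t j \<le> B" if "j \<in> I" for j
  proof -
    have "real r * t j = (\<Sum>i<r. t j)" by simp
    also have "\<dots> \<le> S"
      unfolding S_def using that by (intro sum_mono D(4)) (auto simp: I_def)
    also have "\<dots> \<le> \<kappa> * S" using mult_right_mono[OF \<kappa> S0] by simp
    finally show ?thesis unfolding B_def using r by (simp add: field_simps)
  qed
  have t_sum: "(\<Sum>j\<in>I. t j) \<le> real r * B"
    using tail_le r splitJI[of t] S_J unfolding B_def S_def[symmetric] by (simp add: algebra_simps)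
  define w where "w = (\<Sum>j\<in>J. t j *\<^sub>R E j)"
  \<comment> \<open>The values at \<open>E j\<close> of the functional
    \<open>Z \<mapsto> - (A Z \<bullet> A w)\<close>. Since \<open>A H = 0\<close>, it takes the
    value \<open>(norm (A w))\<^sup>2\<close> at the tail of \<open>H\<close>.\<close>
  define c where "c j = - (A (E j) \<bullet> A w)" for j
  obtain T \<theta> where T: "T \<subseteq> I" "card T \<le> r" "\<forall>j\<in>T. \<theta> \<le> c j" "\<forall>j\<in>I - T. c j \<le> \<theta>"
    "0 \<le> \<theta>" "\<theta> = 0 \<or> card T = r"
    using exists_top_subset[OF JI(4), of r c] by blast
  have finT: "finite T" using T(1) JI(4) finite_subset by blast
  have JT: "J \<inter> T = {}" "J \<union> T \<subseteq> {..<q}" using T(1) JI by blast+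
  \<comment> \<open>The extremal weights: \<open>B\<close> on the selected tail indices. Their
    disjointness from \<open>J\<close> makes \<open>U\<close> orthogonal to
    \<open>w\<close>.\<close>
  define U where "U = (\<Sum>j\<in>T. B *\<^sub>R E j)"
  have sum_A: "A (\<Sum>j\<in>K. g j *\<^sub>R E j) \<bullet> A w = (\<Sum>j\<in>K. g j * (- c j))" for K g
    unfolding c_def by (simp add: linear_sum[OF lin] linear_cmul[OF lin] inner_sum_left)
  have "H = w + (\<Sum>j\<in>I. t j *\<^sub>R E j)"
    unfolding w_def splitJI[symmetric] E_def by (rule D(7))
  then have "A w + A (\<Sum>j\<in>I. t j *\<^sub>R E j) = 0"
    using H(2) linear_add[OF lin] by metis
  then have "A w \<bullet> A w + A (\<Sum>j\<in>I. t j *\<^sub>R E j) \<bullet> A w = 0"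
    by (metis inner_add_left inner_zero_left)
  then have "(norm (A w))\<^sup>2 = (\<Sum>j\<in>I. t j * c j)"
    by (simp add: sum_A sum_negf power2_norm_eq_inner)
  also have "\<dots> \<le> B * (\<Sum>j\<in>T. c j)"
    by (rule sum_mult_le_threshold[OF JI(4) T(1), of \<theta> c r t B])
      (use T t_le t_sum D(3) in auto)
  also have "\<dots> = - (A U \<bullet> A w)"
    unfolding U_def sum_A by (simp add: sum_distrib_left sum_negf)
  finally have Aw: "(norm (A w))\<^sup>2 \<le> - (A U \<bullet> A w)" .
  \<comment> \<open>One statement for \<open>w\<close>, \<open>w + U\<close> and
    \<open>w - U\<close>, used at \<open>\<sigma> = 0\<close>, \<open>1\<close> and
    \<open>-1\<close>.\<close>
  have V: "rank (w + \<sigma> *\<^sub>R U) \<le> 2 * r"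
    "(norm (w + \<sigma> *\<^sub>R U))\<^sup>2 = (\<Sum>j\<in>J. (t j)\<^sup>2) + \<sigma>\<^sup>2 * (real (card T) * B\<^sup>2)" for \<sigma>
  proof -
    define g where "g j = (if j \<in> J then t j else \<sigma> * B)" for j
    have split: "(\<Sum>j\<in>J \<union> T. h j) = (\<Sum>j\<in>J. h j) + (\<Sum>j\<in>T. h j)" for h :: "nat \<Rightarrow> 'c::comm_monoid_add"
      using JT JI finT by (simp add: sum.union_disjoint)
    have gT: "g j = \<sigma> * B" if "j \<in> T" for j using that JT by (auto simp: g_def)
    have eq: "w + \<sigma> *\<^sub>R U = (\<Sum>j\<in>J \<union> T. g j *\<^sub>R E j)"
      unfolding split w_def U_def scaleR_sum_right
      using JT(1) by (intro arg_cong2[of _ _ _ _ "(+)"] sum.cong) (auto simp: g_def)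
    have "card (J \<union> T) \<le> card J + card T" by (rule card_Un_le)
    also have "\<dots> \<le> 2 * r" using T(2) by (simp add: J_def)
    finally show "rank (w + \<sigma> *\<^sub>R U) \<le> 2 * r"
      unfolding eq E_def using rank_sum_outer_le[of "J \<union> T" g a b] JI finT by simp
    have "(norm (w + \<sigma> *\<^sub>R U))\<^sup>2 = (\<Sum>j\<in>J \<union> T. (g j)\<^sup>2)"
      unfolding eq power2_norm_eq_inner orthonormal_seq_inner_sum_sum[OF E JT(2)]
      by (simp add: power2_eq_square)
    also have "\<dots> = (\<Sum>j\<in>J. (t j)\<^sup>2) + \<sigma>\<^sup>2 * (real (card T) * B\<^sup>2)"
      unfolding split by (simp add: gT power_mult_distrib) (simp add: g_def)
    finally show "(norm (w + \<sigma> *\<^sub>R U))\<^sup>2 = (\<Sum>j\<in>J. (t j)\<^sup>2) + \<sigma>\<^sup>2 * (real (card T) * B\<^sup>2)" .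
  qed
  define n where "n = (\<Sum>j\<in>J. (t j)\<^sup>2)"
  define m where "m = real (card T) * B\<^sup>2"
  \<comment> \<open>As \<open>H\<close> is nonzero and \<open>0 < r\<close>, the index 0 of the
    largest singular value lies in \<open>J\<close>, so \<open>n\<close> is positive and can be
    cancelled at the end.\<close>
  have "q \<noteq> 0" using H(3) D(7) by (metis lessThan_0 sum.empty)
  then have "0 < (t 0)\<^sup>2" using D(1)[of 0] by simp
  also have "\<dots> \<le> n"
    unfolding n_def by (rule member_le_sum) (use r \<open>q \<noteq> 0\<close> JI in \<open>auto simp: J_def\<close>)
  finally have n0: "0 < n" .
  \<comment> \<open>Cauchy-Schwarz over at most \<open>r\<close> indices gives
    \<open>S\<^sup>2 \<le> n * r\<close>, while
    \<open>r * B\<^sup>2 = \<kappa>\<^sup>2 * S\<^sup>2 / r\<close>.\<close>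
  have mn: "m \<le> \<kappa>\<^sup>2 * n"
  proof -
    have "S\<^sup>2 \<le> (\<Sum>j\<in>J. (t j)\<^sup>2) * real (card J)"
      unfolding S_J using Cauchy_Schwarz_ineq_sum[of t "\<lambda>_. 1" J] by simp
    also have "\<dots> \<le> n * real r"
      using n0 by (intro mult_mono) (auto simp: n_def J_def)
    finally have "S\<^sup>2 \<le> n * real r" .
    have "m \<le> real r * B\<^sup>2" unfolding m_def using T(2) by (intro mult_right_mono) auto
    also have "\<dots> = \<kappa>\<^sup>2 * (S\<^sup>2 / real r)"
      using r unfolding B_def by (simp add: power2_eq_square)
    also have "\<dots> \<le> \<kappa>\<^sup>2 * n"
      using \<open>S\<^sup>2 \<le> n * real r\<close> r by (intro mult_left_mono) (auto simp: field_simps)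
    finally show ?thesis .
  qed
  \<comment> \<open>\<open>w + U\<close> and \<open>w - U\<close> have equal norm, so their isometry
    bounds differ by \<open>2 * \<delta> * (n + m)\<close>; by polarization their squared images
    differ by at least \<open>4 * (norm (A w))\<^sup>2\<close>.\<close>
  have "(1 - \<delta>) * n \<le> (norm (A w))\<^sup>2"
    using rip[OF V(1)[of 0]] V(2)[of 0] by (simp add: n_def)
  moreover have "(1 - \<delta>) * (n + m) \<le> (norm (A (w + U)))\<^sup>2"
    using rip[OF V(1)[of 1]] V(2)[of 1] by (simp add: n_def m_def)
  moreover have "(norm (A (w - U)))\<^sup>2 \<le> (1 + \<delta>) * (n + m)"
    using rip[OF V(1)[of "-1"]] V(2)[of "-1"] by (simp add: n_def m_def)
  moreover have "(norm (A (w - U)))\<^sup>2 - (norm (A (w + U)))\<^sup>2 = - 4 * (A U \<bullet> A w)"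
    by (simp add: linear_diff[OF lin] linear_add[OF lin] power2_norm_eq_inner inner_diff_left
        inner_diff_right inner_add_left inner_add_right inner_commute)
  ultimately have "4 * ((1 - \<delta>) * n) \<le> (1 + \<delta>) * (n + m) - (1 - \<delta>) * (n + m)"
    using Aw by linarith
  also have "\<dots> = 2 * (\<delta> * n + \<delta> * m)" by (simp add: algebra_simps)
  also have "\<dots> \<le> 2 * (\<delta> * n + \<delta> * (\<kappa>\<^sup>2 * n))"
    using mult_left_mono[OF mn \<delta>(1)] by simp
  finally have "2 * n \<le> \<delta> * (3 + \<kappa>\<^sup>2) * n" by (simp add: algebra_simps)
  then show False using \<delta>(2) n0 by simp
qed

section \<open>From the restricted isometry constant to unique recovery\<close>

text \<open>Any admissible value below \<open>d\<close> serves, so attainment of the infimum is not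
  at issue. Extracting one requires a nonempty set, which boundedness of \<open>A\<close>
  provides.\<close>

lemma rip_const_less_imp:
  fixes A :: "real^'n^'m \<Rightarrow> real^'p"
  assumes lin: "linear A" and less: "rip_const A k < d"
  obtains \<delta> where "0 \<le> \<delta>" "\<delta> < d"
    "\<And>X. rank X \<le> k \<Longrightarrow>
      (1 - \<delta>) * (norm X)\<^sup>2 \<le> (norm (A X))\<^sup>2 \<and> (norm (A X))\<^sup>2 \<le> (1 + \<delta>) * (norm X)\<^sup>2"
proof -
  let ?D = "{\<delta>. \<delta> \<ge> 0 \<and> (\<forall>X::real^'n^'m. rank X \<le> k \<longrightarrow>
       (1 - \<delta>) * (frob_norm X)^2 \<le> (norm (A X))^2 \<and>
       (norm (A X))^2 \<le> (1 + \<delta>) * (frob_norm X)^2)}"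
  \<comment> \<open>\<open>1 \<le> \<Delta>\<close> makes the lower bound trivial, and the operator
    norm gives the upper one.\<close>
  define \<Delta> where "\<Delta> = 1 + (onorm A)\<^sup>2"
  have "(norm (A X))\<^sup>2 \<le> (1 + \<Delta>) * (norm X)\<^sup>2" for X
  proof -
    have "norm (A X) \<le> onorm A * norm X"
      using lin by (intro onorm) (simp add: linear_conv_bounded_linear)
    then have "(norm (A X))\<^sup>2 \<le> (onorm A * norm X)\<^sup>2" by (intro power_mono) auto
    also have "\<dots> \<le> (1 + \<Delta>) * (norm X)\<^sup>2"
      unfolding power_mult_distrib by (intro mult_right_mono) (auto simp: \<Delta>_def)
    finally show ?thesis .
  qed
  moreover have "(1 - \<Delta>) * (norm X)\<^sup>2 \<le> (norm (A X))\<^sup>2" for X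
    by (rule order.trans[of _ 0]) (auto simp: \<Delta>_def mult_nonpos_nonneg)
  ultimately have "\<Delta> \<in> ?D" by (simp add: frob_norm_eq_norm \<Delta>_def)
  then obtain \<delta> where "\<delta> \<in> ?D" "\<delta> < d"
    using cInf_lessD[of ?D d] less unfolding rip_const_def by blast
  then show ?thesis using that[of \<delta>] by (simp add: frob_norm_eq_norm)
qed

theorem mainTheorem10:
  fixes A :: "real^'n2^'n1 \<Rightarrow> real^'m"
    and X0 :: "real^'n2^'n1"
    and r :: nat and \<alpha> :: real
  assumes "linear A"
    and "rank X0 \<le> r"
    and "rip_const A (2 * r) < 0.4404"
    and "\<alpha> > 0"
    and "\<alpha> \<ge> 10 * spec_norm X0"
  shows "A X0 = A X0 \<and>
         (\<forall>X. A X = A X0 \<and> X \<noteq> X0 \<longrightarrow> N2_obj \<alpha> X0 < N2_obj \<alpha> X)"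
proof (intro conjI allI impI)
  fix X assume X: "A X = A X0 \<and> X \<noteq> X0"
  define H where "H = X - X0"
  have AH: "A H = 0" using X by (simp add: H_def linear_diff[OF assms(1)])
  have H0: "H \<noteq> 0" using X by (simp add: H_def)
  obtain \<delta> where \<delta>: "0 \<le> \<delta>" "\<delta> < 0.4404"
    and rip: "\<And>X. rank X \<le> 2 * r \<Longrightarrow>
      (1 - \<delta>) * (norm X)\<^sup>2 \<le> (norm (A X))\<^sup>2 \<and> (norm (A X))\<^sup>2 \<le> (1 + \<delta>) * (norm X)\<^sup>2"
    using rip_const_less_imp[OF assms(1,3)] by blast
  obtain p s u v where svd0: "sorted_svd X0 p s u v" by (rule exists_sorted_svd)
  obtain q t a b where svdH: "sorted_svd H q t a b" by (rule exists_sorted_svd)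
  note t0 = sorted_svdD(3)[OF svdH]
  have pr: "p \<le> r" using sorted_svd_rank[OF svd0] assms(2) by simp
  define F where "F = (\<Sum>j<r. t j)"
  have F0: "0 \<le> F" unfolding F_def by (intro sum_nonneg t0)
  have "(\<Sum>k<p. t k) \<le> F"
    unfolding F_def by (rule sum_mono2) (use pr t0 in auto)
  moreover have "nuc_norm (H - (- X0)) = nuc_norm X" by (simp add: H_def)
  ultimately have nuc: "nuc_norm X0 + (\<Sum>k<q. t k) - 2 * F \<le> nuc_norm X"
    using nuc_norm_diff_ge[OF sorted_svd_uminus[OF svd0] svdH] nuc_norm_eq[OF svd0] by linarith
  have "\<bar>X0 \<bullet> H\<bar> \<le> spec_norm X0 * F"
    unfolding F_def by (rule abs_inner_le_spec_norm_ky_fan[OF svd0 svdH pr])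
  also have "\<dots> \<le> (\<alpha> / 10) * F" using assms(5) F0 by (intro mult_right_mono) auto
  finally have "- (\<alpha> * F / 10) \<le> X0 \<bullet> H" by simp
  then have inner: "- (F / 10) \<le> (X0 \<bullet> H) / \<alpha>" using assms(4) by (simp add: field_simps)
  have "(norm X)\<^sup>2 = (norm X0)\<^sup>2 + 2 * (X0 \<bullet> H) + (norm H)\<^sup>2"
    by (simp add: H_def power2_norm_eq_inner inner_diff_left inner_diff_right inner_commute)
  then have frob: "(norm X)\<^sup>2 / (2 * \<alpha>)
      = (norm X0)\<^sup>2 / (2 * \<alpha>) + (X0 \<bullet> H) / \<alpha> + (norm H)\<^sup>2 / (2 * \<alpha>)"
    by (simp add: add_divide_distrib)
  \<comment> \<open>This quadratic term makes the final inequality strict, so a non-strict bound on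
    \<open>F\<close> suffices.\<close>
  have pos: "0 < (norm H)\<^sup>2 / (2 * \<alpha>)" using H0 assms(4) by simp
  \<comment> \<open>\<open>2.1 = 2 + 1/10\<close>: a loss of \<open>2 * F\<close> in the nuclear
    norm and of \<open>F / 10\<close> in the inner product.\<close>
  have "2.1 * F \<le> (\<Sum>k<q. t k)"
  proof (cases "r = 0")
    case True
    then show ?thesis by (simp add: F_def sum_nonneg t0)
  next
    case False
    \<comment> \<open>With \<open>\<kappa> = 1.1\<close> the factor is \<open>4.21\<close>, and
      \<open>0.4404 * 4.21 < 2\<close>.\<close>
    have "\<delta> * (3 + (1.1)\<^sup>2) < 2" using \<delta> by (simp add: power2_eq_square)
    then have "(1 + 1.1) * F < (\<Sum>k<q. t k)"
      unfolding F_def using False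
      by (intro rip_null_space_property[OF assms(1) \<delta>(1) _ _ rip svdH AH H0]) auto
    then show ?thesis by simp
  qed
  then show "N2_obj \<alpha> X0 < N2_obj \<alpha> X"
    using nuc inner frob pos unfolding N2_obj_def frob_norm_eq_norm by simp
qed simp

end
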